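(* Let $\mathcal{H}$ denote the Hurwitz class. (a) If $f\in\mathcal{H}$, $f(z)=z+\sum_{k=2}^\infty a_kz^k$, and $n\ge 2$, then $$ n^2|a_n|^2+(2n-1)|a_{2n-1}|\le 1. \qquad (\mathrm{i})$$ This single inequality is equivalent to $$ |\lambda a_n^2-a_{2n-1}|\le \max\left\{\frac{|\lambda|}{n^2},\frac{1}{2n-1}\right\}\quad\text{for all }\lambda\in\mathbb{C}. \qquad (\mathrm{ii})$$ For a given $\lambda$, equality holds in the inequality in (ii) if and only if $$ f(z)=\begin{cases} z+\frac{\alpha}{2n-1}z^{2n-1}, & \text{for } |\lambda|\le \frac{n^2}{2n-1},\\ z+\frac{\alpha}{n}z^{n}, & \text{for } |\lambda|\ge \frac{n^2}{2n-1},\end{cases}$$ where $\alpha$ is a complex number of modulus one (both forms are allowed when $|\lambda|=\frac{n^2}{2n-1}$). (b) If $f\in\mathcal{H}$, $f(z)=z+\sum_{k=2}^\infty a_kz^k$, then for any two distinct values $m,n\ge2$ we have $$ 4mn|a_ma_n|+(m+n-1)|a_{m+n-1}|\le1. \qquad (\mathrm{iii})$$ This inequality is equivalent to $$ |\lambda a_ma_n-a_{m+n-1}|\le\max\left\{\frac{|\lambda|}{4mn},\frac{1}{m+n-1}\right\}\quad\text{for all }\lambda\in\mathbb{C}. \qquad (\mathrm{iv})$$ For a given $\lambda$, equality holds in the inequality in (iv) if and only if $$ f(z)=\begin{cases} z+\frac{\alpha}{m+n-1}z^{m+n-1}, & \text{for } |\lambda|\le\frac{4mn}{m+n-1},\\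 z+\frac{\alpha}{2m}z^m+\frac{\beta}{2n}z^n, & \text{for } |\lambda|\ge\frac{4mn}{m+n-1},\end{cases}$$ where $\alpha$ and $\beta$ are complex numbers such that $|\alpha|=|\beta|=1$ (both forms are allowed when $|\lambda|=\frac{4mn}{m+n-1}$).
   Context: $\mathbb{D}$ is the open unit disk in $\mathbb{C}$. The Hurwitz class $\mathcal{H}$ is the set of all functions $f(z)=z+a_2z^2+a_3z^3+\cdots$ analytic in $\mathbb{D}$ such that $\sum_{n=2}^\infty n|a_n|\le1$. Here $m,n$ are integers. *)

theory Defs
  imports "HOL-Complex_Analysis.Complex_Analysis"
begin

text \<open>
  The series \<open>f(z) = z + a\<^sub>2 z\<^sup>2 + a\<^sub>3 z\<^sup>3 + \<dots>\<close> in the unit disk.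
  The values \<open>a 0\<close> and \<open>a 1\<close> play no role.
\<close>

definition has_normalized_expansion :: "(complex \<Rightarrow> complex) \<Rightarrow> (nat \<Rightarrow> complex) \<Rightarrow> bool" where
  "has_normalized_expansion f a \<longleftrightarrow>
     (\<forall>z\<in>ball 0 1. (\<lambda>k. a (k + 2) * z ^ (k + 2)) sums (f z - z))"

text \<open>
  Functions are total in HOL, so membership constrains \<open>f\<close> on the unit disk only. Summability is
  required explicitly because \<open>suminf\<close> of a divergent series is unspecified.
\<close>

definition hurwitz_class :: "(complex \<Rightarrow> complex) set" where
  "hurwitz_class =
     {f. f analytic_on ball 0 1 \<and>
         (\<exists>a. has_normalized_expansion f a \<and>
              summable (\<lambda>k. real (k + 2) * cmod (a (k + 2))) \<and>
              (\<Sum>k. real (k + 2) * cmod (a (k + 2))) \<le> 1)}"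

end

theory Submission
  imports Defs
begin

text \<open>
  The coefficients of a Hurwitz function satisfy \<open>m|a\<^sub>m| + n|a\<^sub>n| + j|a\<^sub>j| \<le> 1\<close> for distinct indices,
  and \<open>s\<^sup>2 \<le> s\<close> on the unit interval turns this into (i), and, with \<open>4xy \<le> (x + y)\<^sup>2\<close>, into (iii).
  Both equivalences are instances of the fact that \<open>p|u| + q|v| \<le> 1\<close> holds iff
  \<open>|\<lambda>u - v| \<le> max (|\<lambda>|/p) (1/q)\<close> for all \<open>\<lambda>\<close>: for the converse, take \<open>|\<lambda>| = p/q\<close> with the argument
  for which \<open>\<lambda>u\<close> and \<open>-v\<close> are aligned. Equality in (ii) or (iv) forces equality in (i) or (iii),
  hence the coefficients involved exhaust the Hurwitz sum and all others vanish.
\<close>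

section \<open>Uniqueness of coefficients and polynomial expansions\<close>

lemma normalized_expansion_unique:
  assumes "has_normalized_expansion f a" "has_normalized_expansion f b" "2 \<le> k"
  shows "a k = b k"
proof (rule ccontr)
  assume "a k \<noteq> b k"
  \<comment> \<open>Setting the entries below 2 to 0 turns the shifted series of differences into a
    full power series with sum 0.\<close>
  define c where "c k = (if k < 2 then 0 else a k - b k)" for k
  have "(\<lambda>i. c i * z ^ i) sums 0" if "z \<in> ball 0 1" for z
  proof -
    have "(\<lambda>i. a (i + 2) * z ^ (i + 2) - b (i + 2) * z ^ (i + 2)) sums ((f z - z) - (f z - z))"
      using assms that unfolding has_normalized_expansion_def by (intro sums_diff) blast+
    then have "(\<lambda>i. c (i + 2) * z ^ (i + 2)) sums (0 - (\<Sum>i<2. c i * z ^ i))"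
      by (simp add: c_def algebra_simps)
    then show ?thesis
      by (subst (asm) sums_iff_shift) simp
  qed
  moreover have "c k \<noteq> 0" "0 < k"
    using \<open>a k \<noteq> b k\<close> \<open>2 \<le> k\<close> by (auto simp: c_def)
  \<comment> \<open>Zeros of a power series are isolated: a nonzero coefficient of positive index
    would make the sum nonzero on some punctured disk. The sum is constantly 0, so the point
    \<open>s\<close> of that punctured disk gives the contradiction.\<close>
  ultimately show False
  proof (elim powser_0_nonzero[where r = 1 and \<xi> = 0 and f = "\<lambda>_. 0", rotated 3])
    fix s :: real
    assume "0 < s" and nonzero: "\<And>z::complex. z \<in> cball 0 s - {0} \<Longrightarrow> (0::complex) \<noteq> 0"
    then have "complex_of_real s \<in> cball 0 s - {0}"
      by auto
    from nonzero[OF this] show False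
      by simp
  qed auto
qed

text \<open>Uniqueness of coefficients gives one direction, uniqueness of the sum of a series the
  other. This reduces claims about the shape of an extremal \<open>f\<close> to claims about its
  coefficients.\<close>

lemma normalized_expansion_polynomial_iff:
  assumes f: "has_normalized_expansion f a" and S: "finite S" "S \<subseteq> {2..}"
  shows "(\<forall>z\<in>ball 0 1. f z = z + (\<Sum>k\<in>S. c k * z ^ k))
     \<longleftrightarrow> (\<forall>k\<ge>2. a k = (if k \<in> S then c k else 0))"
proof -
  define b where "b k = (if k \<in> S then c k else 0)" for k
  have b: "(\<lambda>k. b (k + 2) * z ^ (k + 2)) sums (\<Sum>k\<in>S. c k * z ^ k)" for z
  proof -
    have "(\<lambda>k. if k \<in> S then c k * z ^ k else 0) sums (\<Sum>k\<in>S. c k * z ^ k)"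
      using S(1) by (rule sums_If_finite_set)
    also have "(\<lambda>k. if k \<in> S then c k * z ^ k else 0) = (\<lambda>k. b k * z ^ k)"
      by (auto simp: b_def)
    finally have "(\<lambda>k. b (k + 2) * z ^ (k + 2)) sums ((\<Sum>k\<in>S. c k * z ^ k) - (\<Sum>k<2. b k * z ^ k))"
      by (subst sums_iff_shift) simp
    moreover have "(\<Sum>k<2. b k * z ^ k) = 0"
      using S(2) by (intro sum.neutral) (auto simp: b_def)
    ultimately show ?thesis
      by simp
  qed
  show ?thesis
  proof
    assume "\<forall>z\<in>ball 0 1. f z = z + (\<Sum>k\<in>S. c k * z ^ k)"
    then have "has_normalized_expansion f b"
      using b by (simp add: has_normalized_expansion_def)
    then show "\<forall>k\<ge>2. a k = (if k \<in> S then c k else 0)"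
      using normalized_expansion_unique[OF f] by (simp add: b_def)
  next
    assume "\<forall>k\<ge>2. a k = (if k \<in> S then c k else 0)"
    then have ab: "a (k + 2) = b (k + 2)" for k
      by (simp add: b_def)
    show "\<forall>z\<in>ball 0 1. f z = z + (\<Sum>k\<in>S. c k * z ^ k)"
    proof
      fix z :: complex
      assume "z \<in> ball 0 1"
      then have "(\<lambda>k. b (k + 2) * z ^ (k + 2)) sums (f z - z)"
        using f ab by (simp add: has_normalized_expansion_def)
      from sums_unique2[OF this b] show "f z = z + (\<Sum>k\<in>S. c k * z ^ k)"
        by (simp add: algebra_simps)
    qed
  qed
qed

section \<open>Finite partial sums of the Hurwitz series\<close>

lemma hurwitz_sum_le_1:
  assumes "f \<in> hurwitz_class" "has_normalized_expansion f a" "finite S" "S \<subseteq> {2..}"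
  shows "(\<Sum>k\<in>S. real k * cmod (a k)) \<le> 1"
proof -
  \<comment> \<open>Membership only supplies some expansion \<open>b\<close>; uniqueness identifies
    it with the given \<open>a\<close> from index 2 on.\<close>
  obtain b where b: "has_normalized_expansion f b"
      "summable (\<lambda>k. real (k + 2) * cmod (b (k + 2)))"
      "(\<Sum>k. real (k + 2) * cmod (b (k + 2))) \<le> 1"
    using assms(1) unfolding hurwitz_class_def by blast
  define h where "h k = (if k < 2 then 0 else real k * cmod (b k))" for k
  have shift: "(\<lambda>k. h (k + 2)) = (\<lambda>k. real (k + 2) * cmod (b (k + 2)))"
    by (auto simp: h_def)
  have h: "summable h"
    using b(2) unfolding shift[symmetric] by (subst (asm) summable_iff_shift)
  have "(\<Sum>k\<in>S. real k * cmod (a k)) = sum h S"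
  proof (rule sum.cong)
    fix k
    assume "k \<in> S"
    with assms(4) have "2 \<le> k" by auto
    then show "real k * cmod (a k) = h k"
      using normalized_expansion_unique[OF assms(2) b(1)] by (simp add: h_def)
  qed simp
  also have "\<dots> \<le> suminf h"
    using h assms(3) by (rule sum_le_suminf) (simp add: h_def)
  also have "suminf h = (\<Sum>k. h (k + 2)) + (\<Sum>k<2. h k)"
    by (rule suminf_split_initial_segment[OF h])
  also have "(\<Sum>k<2. h k) = 0"
    by (simp add: h_def)
  also have "(\<Sum>k. h (k + 2)) + 0 \<le> 1"
    using b(3) by (simp only: shift add_0_right)
  finally show ?thesis .
qed

text \<open>If the indices in \<open>S\<close> already use up the total weight 1, adding one more
  index leaves it only weight 0. This is how equality in a coefficient estimate determines the whole
  function.\<close>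

lemma hurwitz_coeff_eq_0:
  assumes "f \<in> hurwitz_class" "has_normalized_expansion f a" "finite S" "S \<subseteq> {2..}"
    and "(\<Sum>k\<in>S. real k * cmod (a k)) = 1" "2 \<le> j" "j \<notin> S"
  shows "a j = 0"
proof -
  have "(\<Sum>k\<in>insert j S. real k * cmod (a k)) \<le> 1"
    using assms by (intro hurwitz_sum_le_1[OF assms(1,2)]) auto
  then have "real j * cmod (a j) \<le> 0"
    using assms by simp
  then show ?thesis
    using \<open>2 \<le> j\<close> by (simp add: mult_le_0_iff)
qed

section \<open>Extremal functions characterised by the moduli of their coefficients\<close>

lemma hurwitz_monomial_iff:
  assumes "f \<in> hurwitz_class" "has_normalized_expansion f a" "2 \<le> j"
  shows "(\<exists>\<alpha>. cmod \<alpha> = 1 \<and> (\<forall>z\<in>ball 0 1. f z = z + \<alpha> / of_nat j * z ^ j))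
     \<longleftrightarrow> real j * cmod (a j) = 1" (is "?L \<longleftrightarrow> ?R")
proof -
  have expand: "(\<forall>z\<in>ball 0 1. f z = z + \<alpha> / of_nat j * z ^ j)
      \<longleftrightarrow> (\<forall>k\<ge>2. a k = (if k = j then \<alpha> / of_nat j else 0))" for \<alpha>
    using normalized_expansion_polynomial_iff[OF assms(2), of "{j}" "\<lambda>k. \<alpha> / of_nat k"] assms(3)
    by (simp add: Ball_def)
  show ?thesis
  proof
    assume ?L
    then obtain \<alpha> where "cmod \<alpha> = 1" "a j = \<alpha> / of_nat j"
      using expand assms(3) by auto
    then show ?R
      using assms(3) by (simp add: norm_divide)
  next
    assume ?R
    then have "a k = 0" if "2 \<le> k" "k \<noteq> j" for k
      using hurwitz_coeff_eq_0[OF assms(1,2), of "{j}" k] that assms(3) by auto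
    \<comment> \<open>The witness for \<alpha> is \<open>of_nat j * a j\<close>, which has modulus
      one by assumption.\<close>
    then have "\<forall>k\<ge>2. a k = (if k = j then (of_nat j * a j) / of_nat j else 0)"
      using assms(3) by simp
    moreover have "cmod (of_nat j * a j) = 1"
      using \<open>?R\<close> by (simp add: norm_mult)
    ultimately show ?L
      unfolding expand by blast
  qed
qed

text \<open>Two contributions of 1/2 exhaust the Hurwitz sum, so all coefficients other than
  \<open>a m\<close> and \<open>a n\<close> vanish; their arguments stay free and are absorbed into
  \<alpha> and \<beta>.\<close>

lemma hurwitz_binomial_iff:
  assumes "f \<in> hurwitz_class" "has_normalized_expansion f a" "2 \<le> m" "2 \<le> n" "m \<noteq> n"
  shows "(\<exists>\<alpha> \<beta>. cmod \<alpha> = 1 \<and> cmod \<beta> = 1 \<and>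
           (\<forall>z\<in>ball 0 1. f z = z + \<alpha> / of_nat (2 * m) * z ^ m + \<beta> / of_nat (2 * n) * z ^ n))
     \<longleftrightarrow> real m * cmod (a m) = 1 / 2 \<and> real n * cmod (a n) = 1 / 2" (is "?L \<longleftrightarrow> ?R")
proof -
  have expand: "(\<forall>z\<in>ball 0 1. f z = z + \<alpha> / of_nat (2 * m) * z ^ m + \<beta> / of_nat (2 * n) * z ^ n)
      \<longleftrightarrow> (\<forall>k\<ge>2. a k = (if k = m then \<alpha> / of_nat (2 * m) else
                         if k = n then \<beta> / of_nat (2 * n) else 0))" (is "?P \<longleftrightarrow> ?Q") for \<alpha> \<beta>
  proof -
    \<comment> \<open>Both terms are merged into one coefficient function to fit the polynomial
      criterion; \<open>m \<noteq> n\<close> keeps the two values apart.\<close>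
    define c where "c k = (if k = m then \<alpha> / of_nat (2 * m) else \<beta> / of_nat (2 * n))" for k
    have "(\<Sum>k\<in>{m, n}. c k * z ^ k) = \<alpha> / of_nat (2 * m) * z ^ m + \<beta> / of_nat (2 * n) * z ^ n" for z
      using assms(5) by (simp add: c_def)
    then have "?P \<longleftrightarrow> (\<forall>z\<in>ball 0 1. f z = z + (\<Sum>k\<in>{m, n}. c k * z ^ k))"
      by (simp only: add.assoc)
    also have "\<dots> \<longleftrightarrow> (\<forall>k\<ge>2. a k = (if k \<in> {m, n} then c k else 0))"
      using assms by (intro normalized_expansion_polynomial_iff) auto
    also have "(\<lambda>k. if k \<in> {m, n} then c k else 0) =
        (\<lambda>k. if k = m then \<alpha> / of_nat (2 * m) else if k = n then \<beta> / of_nat (2 * n) else 0)"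
      using assms(5) by (auto simp: c_def fun_eq_iff)
    then have "(\<forall>k\<ge>2. a k = (if k \<in> {m, n} then c k else 0)) \<longleftrightarrow> ?Q"
      by (simp only: fun_eq_iff)
    finally show ?thesis .
  qed
  show ?thesis
  proof
    assume ?L
    then obtain \<alpha> \<beta> where "cmod \<alpha> = 1" "cmod \<beta> = 1"
        and a: "\<forall>k\<ge>2. a k = (if k = m then \<alpha> / of_nat (2 * m) else
                         if k = n then \<beta> / of_nat (2 * n) else 0)"
      unfolding expand by blast
    moreover have "a m = \<alpha> / of_nat (2 * m)" "a n = \<beta> / of_nat (2 * n)"
      using a assms by auto
    ultimately show ?R
      using assms by (simp add: norm_divide norm_mult)
  next
    assume ?R
    then have "a k = 0" if "2 \<le> k" "k \<notin> {m, n}" for k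
      using hurwitz_coeff_eq_0[OF assms(1,2), of "{m, n}" k] that assms by auto
    then have "\<forall>k\<ge>2. a k = (if k = m then (of_nat (2 * m) * a m) / of_nat (2 * m) else
                         if k = n then (of_nat (2 * n) * a n) / of_nat (2 * n) else 0)"
      using assms by auto
    moreover have "cmod (of_nat (2 * m) * a m) = 1" "cmod (of_nat (2 * n) * a n) = 1"
      using \<open>?R\<close> by (simp_all add: norm_mult)
    ultimately show ?L
      unfolding expand by blast
  qed
qed

section \<open>Weighted sums of two moduli and their dual description\<close>

lemma norm_diff_le_max_mult:
  fixes u v l :: complex
  assumes "0 < p" "0 < q"
  shows "cmod (l * u - v) \<le> max (cmod l / p) (1 / q) * (p * cmod u + q * cmod v)"
proof -
  have "cmod (l * u - v) \<le> cmod l * cmod u + cmod v"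
    using norm_triangle_ineq4[of "l * u" v] by (simp add: norm_mult)
  \<comment> \<open>Inserting the weights \<open>p\<close> and \<open>q\<close> exposes the two
    entries of the maximum as factors.\<close>
  also have "\<dots> = (cmod l / p) * (p * cmod u) + (1 / q) * (q * cmod v)"
    using assms by simp
  also have "\<dots> \<le> max (cmod l / p) (1 / q) * (p * cmod u) + max (cmod l / p) (1 / q) * (q * cmod v)"
    using assms by (intro add_mono mult_right_mono) auto
  finally show ?thesis
    by (simp add: distrib_left)
qed

lemma weighted_sum_le_1_iff:
  fixes u v :: complex
  assumes "0 < p" "0 < q"
  shows "p * cmod u + q * cmod v \<le> 1 \<longleftrightarrow> (\<forall>l. cmod (l * u - v) \<le> max (cmod l / p) (1 / q))"
proof
  assume *: "p * cmod u + q * cmod v \<le> 1"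
  show "\<forall>l. cmod (l * u - v) \<le> max (cmod l / p) (1 / q)"
  proof
    fix l
    have "0 \<le> max (cmod l / p) (1 / q)"
      using assms by (simp add: le_max_iff_disj)
    from mult_left_le[OF * this] show "cmod (l * u - v) \<le> max (cmod l / p) (1 / q)"
      using norm_diff_le_max_mult[OF assms, of l u v] by linarith
  qed
next
  assume *: "\<forall>l. cmod (l * u - v) \<le> max (cmod l / p) (1 / q)"
  obtain l where l: "cmod l = p / q" "cmod (l * u - v) = p / q * cmod u + cmod v"
  proof
    \<comment> \<open>This rotation carries the direction of \<open>u\<close> to the one opposite to
      \<open>v\<close>, so that the moduli add up in \<open>l * u - v\<close>.\<close>
    let ?t = "cis (Arg v + pi - Arg u)"
    have "u = of_real (cmod u) * cis (Arg u)" "v = of_real (cmod v) * cis (Arg v)"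
      using rcis_cmod_Arg[of u] rcis_cmod_Arg[of v] by (simp_all add: rcis_def)
    then have "of_real (p / q) * ?t * u - v =
        of_real (p / q) * of_real (cmod u) * (?t * cis (Arg u)) - of_real (cmod v) * cis (Arg v)"
      by (metis mult.assoc mult.commute)
    also have "?t * cis (Arg u) = - cis (Arg v)"
      by (simp add: cis_mult) (simp add: complex_eq_iff)
    finally have "of_real (p / q) * ?t * u - v = - of_real (p / q * cmod u + cmod v) * cis (Arg v)"
      by (simp add: algebra_simps)
    then show "cmod (of_real (p / q) * ?t * u - v) = p / q * cmod u + cmod v"
      using assms by (simp add: norm_mult del: of_real_add of_real_mult of_real_divide)
    show "cmod (of_real (p / q) * ?t) = p / q"
      using assms by (simp add: norm_mult norm_divide)
  qed
  \<comment> \<open>For \<open>cmod l = p / q\<close> both entries of the maximum equal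
    \<open>1 / q\<close>; multiplying by \<open>q\<close> then gives the weighted sum.\<close>
  have "p / q * cmod u + cmod v \<le> 1 / q"
    using *[rule_format, of l] l assms by simp
  then show "p * cmod u + q * cmod v \<le> 1"
    using assms by (simp add: pos_le_divide_eq distrib_left mult.commute[of _ q])
qed

text \<open>Equality forces the weighted sum to be 1, \<open>extreme\<close> then removes one of
  \<open>u\<close> and \<open>v\<close>, and the surviving one shows which entry is the maximum.
  Without \<open>extreme\<close>, aligned nonzero \<open>u\<close> and \<open>v\<close> could also
  give equality when \<open>cmod l = p / q\<close>.\<close>

lemma norm_diff_eq_max_iff:
  fixes u v l :: complex
  assumes "0 < p" "0 < q" "p * cmod u + q * cmod v \<le> 1"
    and extreme: "p * cmod u + q * cmod v = 1 \<Longrightarrow> u = 0 \<or> v = 0"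
  shows "cmod (l * u - v) = max (cmod l / p) (1 / q)
     \<longleftrightarrow> cmod l \<le> p / q \<and> q * cmod v = 1 \<or> cmod l \<ge> p / q \<and> p * cmod u = 1"
    (is "?L \<longleftrightarrow> ?R")
proof
  assume ?L
  let ?M = "max (cmod l / p) (1 / q)"
  have "0 < ?M"
    using assms by (simp add: less_max_iff_disj)
  \<comment> \<open>A positive number is bounded by its product with a factor at most 1, so this
    factor is exactly 1.\<close>
  have "?M \<le> ?M * (p * cmod u + q * cmod v)"
    using norm_diff_le_max_mult[OF assms(1,2), of l u v] \<open>?L\<close> by simp
  then have 1: "p * cmod u + q * cmod v = 1"
    using \<open>0 < ?M\<close> assms(3) by (simp add: mult_le_cancel_left1)
  from extreme[OF this] show ?R
  proof
    assume "u = 0"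
    with 1 have "q * cmod v = 1" by simp
    moreover from this have "cmod v = 1 / q"
      using assms by (simp add: field_simps)
    with \<open>?L\<close> \<open>u = 0\<close> have "cmod l / p \<le> 1 / q"
      by simp
    ultimately show ?R
      using assms by (simp add: field_simps)
  next
    assume "v = 0"
    with 1 have "p * cmod u = 1" by simp
    moreover from this have "cmod u = 1 / p"
      using assms by (simp add: field_simps)
    with \<open>?L\<close> \<open>v = 0\<close> have "1 / q \<le> cmod l / p"
      by (simp add: norm_mult)
    ultimately show ?R
      using assms by (simp add: field_simps)
  qed
next
  assume ?R
  then show ?L
  proof (elim disjE conjE)
    assume *: "cmod l \<le> p / q" "q * cmod v = 1"
    \<comment> \<open>The term in \<open>v\<close> already reaches the bound 1, which leaves nothing
      for \<open>u\<close>.\<close>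
    with assms have "p * cmod u \<le> 0" by simp
    with assms have "u = 0" by (simp add: mult_le_0_iff)
    moreover have "cmod v = 1 / q"
      using * assms by (simp add: field_simps)
    moreover have "cmod l / p \<le> 1 / q"
      using * assms by (simp add: field_simps)
    ultimately show ?L by simp
  next
    assume *: "cmod l \<ge> p / q" "p * cmod u = 1"
    with assms have "q * cmod v \<le> 0" by simp
    with assms have "v = 0" by (simp add: mult_le_0_iff)
    moreover have "cmod u = 1 / p"
      using * assms by (simp add: field_simps)
    moreover have "1 / q \<le> cmod l / p"
      using * assms by (simp add: field_simps)
    ultimately show ?L by (simp add: norm_mult)
  qed
qed

section \<open>Elementary real inequalities with their equality cases\<close>

lemma square_plus_le_1:
  fixes x y :: real
  assumes "0 \<le> x" "0 \<le> y" "x + y \<le> 1"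
  shows "x\<^sup>2 + y \<le> 1" and "x\<^sup>2 + y = 1 \<Longrightarrow> x = 0 \<or> x = 1"
proof -
  \<comment> \<open>The quantity \<open>x * (1 - x)\<close> is the amount lost in replacing
    \<open>x\<close> by its square; equality in the conclusion forces this loss to be 0.\<close>
  have *: "0 \<le> x * (1 - x)"
    using assms by simp
  then show "x\<^sup>2 + y \<le> 1"
    using assms by (simp add: power2_eq_square algebra_simps)
  assume "x\<^sup>2 + y = 1"
  then have "x * (1 - x) \<le> 0"
    using assms by (simp add: power2_eq_square algebra_simps)
  with * have "x * (1 - x) = 0"
    by linarith
  then show "x = 0 \<or> x = 1"
    by simp
qed

text \<open>Writing \<open>4 * x * w\<close> as a difference of squares reduces this to the square
  inequality for \<open>x + w\<close>. In the equality case the subtracted square vanishes, so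
  \<open>x = w\<close>, and \<open>x + w\<close> is 0 or 1.\<close>

lemma product_plus_le_1:
  fixes x w y :: real
  assumes "0 \<le> x" "0 \<le> w" "0 \<le> y" "x + w + y \<le> 1"
  shows "4 * x * w + y \<le> 1"
    and "4 * x * w + y = 1 \<Longrightarrow> x = 0 \<and> w = 0 \<or> x = 1 / 2 \<and> w = 1 / 2"
proof -
  have eq: "4 * x * w = (x + w)\<^sup>2 - (x - w)\<^sup>2"
    by (simp add: power2_eq_square algebra_simps)
  note s = square_plus_le_1[of "x + w" y]
  show "4 * x * w + y \<le> 1"
    using s(1) assms zero_le_power2[of "x - w"] unfolding eq by linarith
  assume *: "4 * x * w + y = 1"
  then have "(x - w)\<^sup>2 \<le> 0" "(x + w)\<^sup>2 + y = 1"
    using s(1) assms zero_le_power2[of "x - w"] unfolding eq by linarith+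
  then have "x = w" "x + w = 0 \<or> x + w = 1"
    using s(2) assms by auto
  then show "x = 0 \<and> w = 0 \<or> x = 1 / 2 \<and> w = 1 / 2"
    by auto
qed

theorem theorem3:
  shows
   "(\<forall>n::nat. n \<ge> 2 \<longrightarrow>
       (\<forall>f a. f \<in> hurwitz_class \<and> has_normalized_expansion f a \<longrightarrow>
          real n ^ 2 * cmod (a n) ^ 2 + real (2 * n - 1) * cmod (a (2 * n - 1)) \<le> 1)
     \<and> (\<forall>a :: nat \<Rightarrow> complex.
          real n ^ 2 * cmod (a n) ^ 2 + real (2 * n - 1) * cmod (a (2 * n - 1)) \<le> 1
          \<longleftrightarrow>
          (\<forall>l::complex. cmod (l * a n ^ 2 - a (2 * n - 1))
              \<le> max (cmod l / real n ^ 2) (1 / real (2 * n - 1))))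
     \<and> (\<forall>f a (l::complex). f \<in> hurwitz_class \<and> has_normalized_expansion f a \<longrightarrow>
          (cmod (l * a n ^ 2 - a (2 * n - 1))
              = max (cmod l / real n ^ 2) (1 / real (2 * n - 1))
           \<longleftrightarrow>
             (cmod l \<le> real n ^ 2 / real (2 * n - 1) \<and>
               (\<exists>\<alpha>. cmod \<alpha> = 1 \<and>
                 (\<forall>z\<in>ball 0 1. f z = z + \<alpha> / of_nat (2 * n - 1) * z ^ (2 * n - 1))))
           \<or> (cmod l \<ge> real n ^ 2 / real (2 * n - 1) \<and>
               (\<exists>\<alpha>. cmod \<alpha> = 1 \<and>
                 (\<forall>z\<in>ball 0 1. f z = z + \<alpha> / of_nat n * z ^ n))))))
    \<and>
    (\<forall>m n::nat. m \<ge> 2 \<and> n \<ge> 2 \<and> m \<noteq> n \<longrightarrow>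
       (\<forall>f a. f \<in> hurwitz_class \<and> has_normalized_expansion f a \<longrightarrow>
          4 * real m * real n * cmod (a m * a n)
            + real (m + n - 1) * cmod (a (m + n - 1)) \<le> 1)
     \<and> (\<forall>a :: nat \<Rightarrow> complex.
          4 * real m * real n * cmod (a m * a n)
            + real (m + n - 1) * cmod (a (m + n - 1)) \<le> 1
          \<longleftrightarrow>
          (\<forall>l::complex. cmod (l * a m * a n - a (m + n - 1))
              \<le> max (cmod l / (4 * real m * real n)) (1 / real (m + n - 1))))
     \<and> (\<forall>f a (l::complex). f \<in> hurwitz_class \<and> has_normalized_expansion f a \<longrightarrow>
          (cmod (l * a m * a n - a (m + n - 1))
              = max (cmod l / (4 * real m * real n)) (1 / real (m + n - 1))
           \<longleftrightarrow>
             (cmod l \<le> 4 * real m * real n / real (m + n - 1) \<and>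
               (\<exists>\<alpha>. cmod \<alpha> = 1 \<and>
                 (\<forall>z\<in>ball 0 1. f z = z + \<alpha> / of_nat (m + n - 1) * z ^ (m + n - 1))))
           \<or> (cmod l \<ge> 4 * real m * real n / real (m + n - 1) \<and>
               (\<exists>\<alpha> \<beta>. cmod \<alpha> = 1 \<and> cmod \<beta> = 1 \<and>
                 (\<forall>z\<in>ball 0 1. f z = z + \<alpha> / of_nat (2 * m) * z ^ m
                                       + \<beta> / of_nat (2 * n) * z ^ n))))))"
proof (intro conjI allI impI)

  \<comment> \<open>The square functional: coefficients at \<open>n\<close> and
    \<open>2 * n - 1\<close>\<close>
  fix n :: nat
  assume n: "2 \<le> n"
  define j where "j = 2 * n - 1"
  \<comment> \<open>Since \<open>n\<close> is at least 2, \<open>2 * n - 1\<close> differs from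
    \<open>n\<close>, so the two coefficients contribute separately to the Hurwitz sum.\<close>
  have j: "2 \<le> j" "j \<noteq> n" and pos: "0 < real n ^ 2" "0 < real j"
    using n by (auto simp: j_def)
  have ineq: "real n ^ 2 * cmod (a n) ^ 2 + real j * cmod (a j) \<le> 1"
    and extreme: "real n ^ 2 * cmod (a n) ^ 2 + real j * cmod (a j) = 1 \<Longrightarrow>
      real n * cmod (a n) = 0 \<or> real n * cmod (a n) = 1"
    and coeffs: "real n * cmod (a n) + real j * cmod (a j) \<le> 1"
    if "f \<in> hurwitz_class \<and> has_normalized_expansion f a" for f a
  proof -
    show "real n * cmod (a n) + real j * cmod (a j) \<le> 1"
      using hurwitz_sum_le_1[of f a "{n, j}"] that n j by auto
    note square_plus_le_1[OF _ _ this]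
    then show "real n ^ 2 * cmod (a n) ^ 2 + real j * cmod (a j) \<le> 1"
      "real n ^ 2 * cmod (a n) ^ 2 + real j * cmod (a j) = 1 \<Longrightarrow>
        real n * cmod (a n) = 0 \<or> real n * cmod (a n) = 1"
      by (simp_all add: power_mult_distrib)
  qed
  show "real n ^ 2 * cmod (a n) ^ 2 + real (2 * n - 1) * cmod (a (2 * n - 1)) \<le> 1"
    if "f \<in> hurwitz_class \<and> has_normalized_expansion f a" for f a
    using ineq[OF that] unfolding j_def .
  show "real n ^ 2 * cmod (a n) ^ 2 + real (2 * n - 1) * cmod (a (2 * n - 1)) \<le> 1
      \<longleftrightarrow> (\<forall>l. cmod (l * a n ^ 2 - a (2 * n - 1))
              \<le> max (cmod l / real n ^ 2) (1 / real (2 * n - 1)))" for a :: "nat \<Rightarrow> complex"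
    using weighted_sum_le_1_iff[OF pos, of "a n ^ 2" "a j"] unfolding j_def norm_power .
  fix f a and l :: complex
  assume fa: "f \<in> hurwitz_class \<and> has_normalized_expansion f a"
  \<comment> \<open>Equality leaves \<open>real n * cmod (a n)\<close> equal to 0 or 1, and in the
    second case the coefficient bound forces \<open>a j = 0\<close>.\<close>
  have "real n ^ 2 * cmod (a n ^ 2) + real j * cmod (a j) = 1 \<Longrightarrow> a n ^ 2 = 0 \<or> a j = 0"
    using extreme[OF fa] coeffs[OF fa] n j by (auto simp: norm_power mult_le_0_iff)
  from norm_diff_eq_max_iff[OF pos _ this, of l]
  have "cmod (l * a n ^ 2 - a j) = max (cmod l / real n ^ 2) (1 / real j) \<longleftrightarrow>
      cmod l \<le> real n ^ 2 / real j \<and> real j * cmod (a j) = 1 \<or>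
      cmod l \<ge> real n ^ 2 / real j \<and> real n ^ 2 * cmod (a n ^ 2) = 1"
    using ineq[OF fa] by (simp add: norm_power)
  \<comment> \<open>A nonnegative number has square 1 only if it is 1; this brings the condition
    into the form of the monomial criterion.\<close>
  also have "real n ^ 2 * cmod (a n ^ 2) = 1 \<longleftrightarrow> real n * cmod (a n) = 1"
    by (simp add: norm_power abs_square_eq_1 flip: power_mult_distrib)
  finally show "cmod (l * a n ^ 2 - a (2 * n - 1))
              = max (cmod l / real n ^ 2) (1 / real (2 * n - 1))
           \<longleftrightarrow>
             (cmod l \<le> real n ^ 2 / real (2 * n - 1) \<and>
               (\<exists>\<alpha>. cmod \<alpha> = 1 \<and>
                 (\<forall>z\<in>ball 0 1. f z = z + \<alpha> / of_nat (2 * n - 1) * z ^ (2 * n - 1))))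
           \<or> (cmod l \<ge> real n ^ 2 / real (2 * n - 1) \<and>
               (\<exists>\<alpha>. cmod \<alpha> = 1 \<and>
                 (\<forall>z\<in>ball 0 1. f z = z + \<alpha> / of_nat n * z ^ n)))"
    unfolding hurwitz_monomial_iff[OF conjunct1[OF fa] conjunct2[OF fa] n]
      hurwitz_monomial_iff[OF conjunct1[OF fa] conjunct2[OF fa] j(1)] j_def[symmetric] .
next

  \<comment> \<open>The product functional: coefficients at \<open>m\<close>, \<open>n\<close> and
    \<open>m + n - 1\<close>\<close>
  fix m n :: nat
  assume mn: "2 \<le> m \<and> 2 \<le> n \<and> m \<noteq> n"
  define j where "j = m + n - 1"
  \<comment> \<open>As \<open>m\<close> and \<open>n\<close> are at least 2,
    \<open>m + n - 1\<close> exceeds both, so three distinct indices enter the Hurwitz sum.\<close>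
  have j: "2 \<le> j" "j \<noteq> m" "j \<noteq> n" and pos: "0 < 4 * real m * real n" "0 < real j"
    using mn by (auto simp: j_def)
  have ineq: "4 * real m * real n * cmod (a m * a n) + real j * cmod (a j) \<le> 1"
    and extreme: "4 * real m * real n * cmod (a m * a n) + real j * cmod (a j) = 1 \<Longrightarrow>
      real m * cmod (a m) = 0 \<and> real n * cmod (a n) = 0 \<or>
      real m * cmod (a m) = 1 / 2 \<and> real n * cmod (a n) = 1 / 2"
    and coeffs: "real m * cmod (a m) + real n * cmod (a n) + real j * cmod (a j) \<le> 1"
    if "f \<in> hurwitz_class \<and> has_normalized_expansion f a" for f a
  proof -
    show "real m * cmod (a m) + real n * cmod (a n) + real j * cmod (a j) \<le> 1"
      using hurwitz_sum_le_1[of f a "{m, n, j}"] that mn j by auto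
    note product_plus_le_1[OF _ _ _ this]
    then show "4 * real m * real n * cmod (a m * a n) + real j * cmod (a j) \<le> 1"
      "4 * real m * real n * cmod (a m * a n) + real j * cmod (a j) = 1 \<Longrightarrow>
        real m * cmod (a m) = 0 \<and> real n * cmod (a n) = 0 \<or>
        real m * cmod (a m) = 1 / 2 \<and> real n * cmod (a n) = 1 / 2"
      by (simp_all add: norm_mult mult_ac)
  qed
  show "4 * real m * real n * cmod (a m * a n)
            + real (m + n - 1) * cmod (a (m + n - 1)) \<le> 1"
    if "f \<in> hurwitz_class \<and> has_normalized_expansion f a" for f a
    using ineq[OF that] unfolding j_def .
  show "4 * real m * real n * cmod (a m * a n)
            + real (m + n - 1) * cmod (a (m + n - 1)) \<le> 1
      \<longleftrightarrow> (\<forall>l. cmod (l * a m * a n - a (m + n - 1))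
              \<le> max (cmod l / (4 * real m * real n)) (1 / real (m + n - 1)))"
    for a :: "nat \<Rightarrow> complex"
    using weighted_sum_le_1_iff[OF pos, of "a m * a n" "a j"] unfolding j_def mult.assoc .
  fix f a and l :: complex
  assume fa: "f \<in> hurwitz_class \<and> has_normalized_expansion f a"
  have "a m * a n = 0 \<or> a j = 0"
    if "4 * real m * real n * cmod (a m * a n) + real j * cmod (a j) = 1"
  proof -
    \<comment> \<open>Either \<open>a m\<close> vanishes, or two contributions of 1/2 exhaust the
      sum and leave nothing for \<open>a j\<close>.\<close>
    have "real m * cmod (a m) = 0 \<or> real j * cmod (a j) \<le> 0"
      using extreme[OF fa that] coeffs[OF fa] by linarith
    then show ?thesis
      using mn j by (auto simp: mult_le_0_iff)
  qed
  from norm_diff_eq_max_iff[OF pos ineq[OF fa] this, of l]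
  have "cmod (l * (a m * a n) - a j) = max (cmod l / (4 * real m * real n)) (1 / real j) \<longleftrightarrow>
      cmod l \<le> 4 * real m * real n / real j \<and> real j * cmod (a j) = 1 \<or>
      cmod l \<ge> 4 * real m * real n / real j \<and> 4 * real m * real n * cmod (a m * a n) = 1" .
  \<comment> \<open>The value of the product alone does not fix its factors. It leaves no room for
    \<open>a j\<close>, however, so equality holds in the coefficient inequality, and among the two
    cases of \<open>extreme\<close> the nonzero product selects the one with both contributions
    1/2.\<close>
  also have "4 * real m * real n * cmod (a m * a n) = 1 \<longleftrightarrow>
      real m * cmod (a m) = 1 / 2 \<and> real n * cmod (a n) = 1 / 2" (is "?l \<longleftrightarrow> ?r")
  proof
    assume ?l
    moreover from this have "real j * cmod (a j) \<le> 0"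
      using ineq[OF fa] by linarith
    then have "a j = 0"
      using pos by (simp add: mult_le_0_iff)
    ultimately show ?r
      using extreme[OF fa] mn by auto
  next
    have "4 * real m * real n * cmod (a m * a n) = 4 * (real m * cmod (a m)) * (real n * cmod (a n))"
      by (simp add: norm_mult)
    then show ?l if ?r
      by (simp add: that)
  qed
  finally show "cmod (l * a m * a n - a (m + n - 1))
              = max (cmod l / (4 * real m * real n)) (1 / real (m + n - 1))
           \<longleftrightarrow>
             (cmod l \<le> 4 * real m * real n / real (m + n - 1) \<and>
               (\<exists>\<alpha>. cmod \<alpha> = 1 \<and>
                 (\<forall>z\<in>ball 0 1. f z = z + \<alpha> / of_nat (m + n - 1) * z ^ (m + n - 1))))
           \<or> (cmod l \<ge> 4 * real m * real n / real (m + n - 1) \<and>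
               (\<exists>\<alpha> \<beta>. cmod \<alpha> = 1 \<and> cmod \<beta> = 1 \<and>
                 (\<forall>z\<in>ball 0 1. f z = z + \<alpha> / of_nat (2 * m) * z ^ m
                                       + \<beta> / of_nat (2 * n) * z ^ n)))"
    unfolding hurwitz_binomial_iff[OF conjunct1[OF fa] conjunct2[OF fa] conjunct1[OF mn]
        conjunct1[OF conjunct2[OF mn]] conjunct2[OF conjunct2[OF mn]]]
      hurwitz_monomial_iff[OF conjunct1[OF fa] conjunct2[OF fa] j(1)] j_def[symmetric] mult.assoc .
qed

end
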